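(* Let $m\ge 1$ be an integer, $\nu\in(0,1]$, $\underline{\lambda}=(\lambda_1,\ldots,\lambda_m)\in(0,\infty)^m$, and let $\{\underline{M}^\nu(t):t\ge 0\}$ be the multivariate alternative fractional Poisson process with parameters $\nu$ and $\underline{\lambda}$. Then the family of $\mathbb{R}^m$-valued random variables $\left\{\frac{\underline{M}^\nu(t)}{t}:t>0\right\}$ satisfies, as $t\to\infty$, the large deviation principle on $\mathbb{R}^m$ with speed $v_t=t$ and good rate function $\Lambda^*:\mathbb{R}^m\to[0,\infty]$ defined by $$\Lambda^*(\underline{x}):=\begin{cases} \sum_{i=1}^m x_i\log\left(\frac{\nu^\nu}{\lambda_i}\frac{x_i}{(s(\underline{x}))^{1-\nu}}\right)-\nu s(\underline{x})+(s(\underline{\lambda}))^{1/\nu} & \text{if } \underline{x}\in[0,\infty)^m,\\ \infty & \text{otherwise,} \end{cases}$$ with the convention $0\log 0=0$ (so that every summand with $x_i=0$ is $0$; in particular $\Lambda^*(\underline{0})=(s(\underline{\lambda}))^{1/\nu}$).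
   Context: Notation: for $\underline{x}=(x_1,\ldots,x_m)\in\mathbb{R}^m$, $s(\underline{x})=\sum_{i=1}^m x_i$, and $\underline{0}$ is the null vector. Mittag-Leffler function: $E_{\alpha,\beta}(x):=\sum_{r\ge 0}\frac{x^r}{\Gamma(\alpha r+\beta)}$. Multivariate alternative fractional Poisson process with parameters $\nu$ and $\underline{\lambda}$: a process $\underline{M}^\nu(t)=(M_1^\nu(t),\ldots,M_m^\nu(t))$, $t\ge 0$, with values in $\{0,1,2,\ldots\}^m$, whose one-dimensional (fixed $t$) distributions are $$P(\underline{M}^\nu(t)=\underline{k})=\frac{(s(\underline{k}))!}{k_1!\cdots k_m!}\prod_{i=1}^m\lambda_i^{k_i}\cdot\frac{(t^\nu)^{s(\underline{k})}}{\Gamma(\nu s(\underline{k})+1)}\cdot\frac{1}{E_{\nu,1}(s(\underline{\lambda})t^\nu)}\quad\text{for all integers } k_1,\ldots,k_m\ge 0.$$ Equivalently, given the sum $s(\underline{M}^\nu(t))$, the vector is multinomial with probabilities $\lambda_i/s(\underline{\lambda})$, and $P(s(\underline{M}^\nu(t))=h)=\frac{(s(\underline{\lambda})t^\nu)^h}{\Gamma(\nu h+1)E_{\nu,1}(s(\underline{\lambda})t^\nu)}$ for integers $h\ge0$. Only these fixed-time distributions are relevant. Large deviation principle: let $\mathcal{Z}$ be a Hausdorff topological space with its Borel $\sigma$-algebra. A rate function is a lower semi-continuous $I:\mathcal{Z}\to[0,\infty]$; it is good if all level sets $\{z\in\mathcal{Z}:I(z)\le\gamma\}$, $\gamma\ge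 0$, are compact. If $v_t\to\infty$ as $t\to\infty$, a family of $\mathcal{Z}$-valued random variables $\{Z_t:t>0\}$ satisfies the large deviation principle (as $t\to\infty$) with speed $v_t$ and rate function $I$ if $\limsup_{t\to\infty}\frac{1}{v_t}\log P(Z_t\in F)\le-\inf_{z\in F}I(z)$ for all closed $F$ and $\liminf_{t\to\infty}\frac{1}{v_t}\log P(Z_t\in G)\ge-\inf_{z\in G}I(z)$ for all open $G$. *)

theory Defs
  imports "HOL-Probability.Probability"
begin

definition Mittag_Leffler :: "real \<Rightarrow> real \<Rightarrow> real \<Rightarrow> real" where
  "Mittag_Leffler \<alpha> \<beta> x = (\<Sum>r. x ^ r / Gamma (\<alpha> * real r + \<beta>))"

definition coord_sum :: "'a::comm_monoid_add ^ 'm::finite \<Rightarrow> 'a" where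
  "coord_sum x = (\<Sum>i\<in>UNIV. x $ i)"

(* The dimension is CARD('m). Only the distributions at fixed times are prescribed.
   At t = 0 the formula is the Dirac mass at the zero vector, since 0 powr nu = 0 and 0 ^ 0 = 1. *)
definition multivariate_alt_fractional_Poisson ::
    "'w measure \<Rightarrow> real \<Rightarrow> real ^ 'm::finite \<Rightarrow> (real \<Rightarrow> 'w \<Rightarrow> nat ^ 'm) \<Rightarrow> bool" where
  "multivariate_alt_fractional_Poisson P \<nu> lam M \<longleftrightarrow>
     (\<forall>t\<ge>0. M t \<in> measurable P (count_space UNIV) \<and>
       (\<forall>k. measure P {\<omega> \<in> space P. M t \<omega> = k} =
          fact (coord_sum k) / (\<Prod>i\<in>UNIV. fact (k $ i)) * (\<Prod>i\<in>UNIV. (lam $ i) ^ (k $ i))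
          * ((t powr \<nu>) ^ coord_sum k / Gamma (\<nu> * real (coord_sum k) + 1))
          * (1 / Mittag_Leffler \<nu> 1 (coord_sum lam * t powr \<nu>))))"

(* Natural logarithm of a probability with log 0 = -infinity, whereas ln 0 = 0 on real. *)
definition log_prob :: "real \<Rightarrow> ereal" where
  "log_prob p = (if p = 0 then -\<infinity> else ereal (ln p))"

definition lower_semicontinuous :: "('z::topological_space \<Rightarrow> ereal) \<Rightarrow> bool" where
  "lower_semicontinuous I \<longleftrightarrow> (\<forall>z. \<forall>y < I z. eventually (\<lambda>w. y < I w) (nhds z))"

definition rate_function :: "('z::t2_space \<Rightarrow> ereal) \<Rightarrow> bool" where
  "rate_function I \<longleftrightarrow> (\<forall>z. 0 \<le> I z) \<and> lower_semicontinuous I"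

definition good_rate_function :: "('z::t2_space \<Rightarrow> ereal) \<Rightarrow> bool" where
  "good_rate_function I \<longleftrightarrow> rate_function I \<and> (\<forall>\<gamma>::real. 0 \<le> \<gamma> \<longrightarrow> compact {z. I z \<le> ereal \<gamma>})"

(* The infimum over the empty set is infinity in ereal. *)
definition large_deviation_principle ::
    "'w measure \<Rightarrow> (real \<Rightarrow> 'w \<Rightarrow> 'z::t2_space) \<Rightarrow> (real \<Rightarrow> real) \<Rightarrow> ('z \<Rightarrow> ereal) \<Rightarrow> bool" where
  "large_deviation_principle P Z v I \<longleftrightarrow>
     filterlim v at_top at_top \<and>
     (\<forall>t>0. Z t \<in> measurable P borel) \<and>
     rate_function I \<and>
     (\<forall>F. closed F \<longrightarrow>
        Limsup at_top (\<lambda>t. log_prob (measure P {\<omega> \<in> space P. Z t \<omega> \<in> F}) / ereal (v t))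
          \<le> - (INF z\<in>F. I z)) \<and>
     (\<forall>G. open G \<longrightarrow>
        Liminf at_top (\<lambda>t. log_prob (measure P {\<omega> \<in> space P. Z t \<omega> \<in> G}) / ereal (v t))
          \<ge> - (INF z\<in>G. I z))"

(* The convention 0 log 0 = 0 needs no case distinction: a summand with x $ i = 0 is 0 * _ = 0. *)
definition Lambda_star :: "real \<Rightarrow> real ^ 'm::finite \<Rightarrow> real ^ 'm \<Rightarrow> ereal" where
  "Lambda_star \<nu> lam x =
     (if \<forall>i. 0 \<le> x $ i
      then ereal ((\<Sum>i\<in>UNIV. x $ i * ln (\<nu> powr \<nu> / lam $ i * (x $ i / coord_sum x powr (1 - \<nu>))))
             - \<nu> * coord_sum x + coord_sum lam powr (1 / \<nu>))
      else \<infinity>)"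

end

theory Submission
  imports Defs "HOL-Real_Asymp.Real_Asymp"
begin

text \<open>The proof compares point probabilities with the rate function and then sums them. For
\<open>t > 0\<close> write \<open>W k\<close> for the numerator \<open>jump_weight \<nu> lam t k\<close> of the probability that
\<open>M t = k\<close>, \<open>Z\<close> for the Mittag-Leffler normalizer, \<open>S = s(lam)^(1/\<nu>)\<close>, and \<open>H\<close> for
\<open>Lambda_core\<close>, that is, for the finite part of the rate function minus the constant \<open>S\<close>.
The factorials and the Gamma function in \<open>W k\<close> satisfy
\<open>ln \<Gamma>(x + 1) = x ln x - x + O(1 + ln (x + 1))\<close>, and if only the leading terms are kept,
\<open>ln (W k)\<close> becomes exactly \<open>- t H(k / t)\<close>. Hence \<open>W k = exp (- t H(k / t))\<close> up to a factor
between \<open>exp (- \<delta> s(k)) / C\<close> and \<open>C exp (\<delta> s(k))\<close>, for every \<open>\<delta> > 0\<close>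
(\<open>jump_weight_bounds\<close>).

Two elementary facts about \<open>H\<close> turn this into the large deviation principle. The inequality
\<open>ln y \<ge> 1 - 1 / y\<close> shows that the minimum of \<open>H\<close> on the orthant is \<open>- S\<close>, attained at a multiple
of \<open>lam\<close>. Multiplying \<open>lam\<close> by \<open>exp a\<close> subtracts \<open>a s(x)\<close> from \<open>H(x)\<close>, so \<open>H\<close> minus any multiple
of \<open>s\<close> is still bounded below (\<open>Lambda_core_tilted_ge\<close>). This gives compact level sets, and
also the upper bound: the tilt allows a factor \<open>exp (- \<delta> s(k))\<close> to be split off at a cost that
vanishes with \<open>\<delta>\<close>, the sum of these factors over all lattice points is a geometric series, and no
separate estimate of the tails is needed (\<open>prob_upper\<close>).

The asymptotics of the Mittag-Leffler function never have to be computed, because the law is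
normalized: \<open>W k / Z \<le> 1\<close> bounds \<open>Z\<close> from below by the weight near the minimizer of \<open>H\<close>, and the
upper bound applied to the sure event bounds \<open>Z\<close> from above; both give the rate \<open>S\<close>. The lower
bound for an open set comes from the single lattice point obtained by rounding down \<open>t x\<close>, since
\<open>H\<close> is continuous on the orthant.\<close>

section \<open>The Stirling exponent of the jump weights\<close>

definition Lambda_core :: "real \<Rightarrow> real ^ 'm::finite \<Rightarrow> real ^ 'm \<Rightarrow> real" where
  "Lambda_core \<nu> lam x =
     (\<Sum>i\<in>UNIV. x $ i * ln (\<nu> powr \<nu> / lam $ i * (x $ i / coord_sum x powr (1 - \<nu>))))
       - \<nu> * coord_sum x"

text \<open>The probability that the process is in state \<open>k\<close> at time \<open>t\<close>, without its normalizer.\<close>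

definition jump_weight :: "real \<Rightarrow> real ^ 'm::finite \<Rightarrow> real \<Rightarrow> nat ^ 'm \<Rightarrow> real" where
  "jump_weight \<nu> lam t k =
     fact (coord_sum k) / (\<Prod>i\<in>UNIV. fact (k $ i)) * (\<Prod>i\<in>UNIV. (lam $ i) ^ (k $ i))
       * ((t powr \<nu>) ^ coord_sum k / Gamma (\<nu> * real (coord_sum k) + 1))"

abbreviation scaled_state :: "real \<Rightarrow> nat ^ 'm::finite \<Rightarrow> real ^ 'm" where
  "scaled_state t k \<equiv> (\<chi> i. real (k $ i) / t)"

abbreviation stirling_term :: "real \<Rightarrow> real" where
  "stirling_term x \<equiv> x * ln x - x"

lemma coord_sum_scaled_state:
  "coord_sum (scaled_state t k) = real (coord_sum k) / t"
  by (simp add: coord_sum_def sum_divide_distrib)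

lemma coord_sum_nonneg: "(\<And>i. 0 \<le> x $ i) \<Longrightarrow> 0 \<le> coord_sum (x :: real ^ 'm::finite)"
  by (simp add: coord_sum_def sum_nonneg)

lemma coord_le_coord_sum:
  "(\<And>i. 0 \<le> x $ i) \<Longrightarrow> x $ i \<le> coord_sum (x :: real ^ 'm::finite)"
  unfolding coord_sum_def by (rule member_le_sum) auto

text \<open>By the mean value theorem, \<open>ln x = ln_Gamma (x + 1) - ln_Gamma x\<close> is a value of the increasing
function \<open>Digamma\<close> between \<open>x\<close> and \<open>x + 1\<close>.\<close>

lemma Digamma_real_bounds:
  fixes x :: real
  assumes "0 < x"
  shows "Digamma x \<le> ln x" and "ln x \<le> Digamma (x + 1)"
proof -
  have "(ln_Gamma has_real_derivative Digamma y) (at y)" if "x \<le> y" for y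
    using that assms by (intro has_field_derivative_ln_Gamma_real) simp
  then obtain z where z: "x < z" "z < x + 1" and
    eq: "ln_Gamma (x + 1) - ln_Gamma x = (x + 1 - x) * Digamma z"
    using MVT2[of x "x + 1" ln_Gamma Digamma] by fastforce
  have "ln_Gamma (x + 1) - ln_Gamma x = ln x"
    using assms Gamma_real_pos[OF assms]
    by (simp add: ln_Gamma_real_pos Gamma_plus1 ln_mult_pos nonpos_Ints_def)
  with eq have "ln x = Digamma z" by simp
  then show "Digamma x \<le> ln x" "ln x \<le> Digamma (x + 1)"
    using z assms by (auto intro!: Polygamma_real_mono)
qed

lemma ln_add_one_diff_le:
  fixes x :: real
  assumes "0 < x"
  shows "ln (x + 1) - ln x \<le> 1 / x"
proof -
  have "ln (x + 1) - ln x = ln (1 + 1 / x)"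
    using assms by (subst ln_divide_pos[symmetric]) (simp_all add: field_simps)
  then show ?thesis using assms ln_add_one_self_le_self[of "1 / x"] by simp
qed

text \<open>With \<open>ln (x + 1)\<close> in place of \<open>ln x\<close> the difference is \<open>0\<close> at \<open>x = 0\<close> and its derivative is
\<open>Digamma (x + 2) - ln (x + 1)\<close>, which lies between \<open>0\<close> and \<open>1 / (x + 1)\<close>. This avoids the singularity
of \<open>ln\<close> at the left end of the interval.\<close>

lemma ln_Gamma_shifted_stirling:
  fixes x :: real
  assumes "0 \<le> x"
  shows "0 \<le> ln_Gamma (x + 1) - (x * ln (x + 1) - x)"
    and "ln_Gamma (x + 1) - (x * ln (x + 1) - x) \<le> ln (x + 1)"
proof -
  define g where "g y = ln_Gamma (y + 1) - (y * ln (y + 1) - y)" for y :: real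
  have deriv: "(g has_real_derivative (Digamma (y + 2) - ln (y + 1))) (at y)" if "0 \<le> y" for y
  proof -
    have "Digamma (y + 2) = Digamma (y + 1) + 1 / (y + 1)"
      using that Digamma_plus1[of "y + 1"] by (simp add: add.assoc)
    moreover have "y / (y + 1) = 1 - 1 / (y + 1)"
      using that by (simp add: field_simps)
    ultimately show ?thesis
      unfolding g_def using that by (auto intro!: derivative_eq_intros)
  qed
  have "g 0 \<le> g x"
  proof (rule DERIV_nonneg_imp_nondecreasing[OF assms])
    fix y assume "0 \<le> y" "y \<le> x"
    then show "\<exists>d. (g has_real_derivative d) (at y) \<and> 0 \<le> d"
      using deriv[of y] Digamma_real_bounds(2)[of "y + 1"] by (auto simp: add.assoc)
  qed
  moreover have "ln (0 + 1) - g 0 \<le> ln (x + 1) - g x"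
  proof (rule DERIV_nonneg_imp_nondecreasing[OF assms])
    fix y assume y: "0 \<le> y" "y \<le> x"
    have "((\<lambda>y. ln (y + 1) - g y) has_real_derivative
        (1 / (y + 1) - (Digamma (y + 2) - ln (y + 1)))) (at y)"
      using y by (auto intro!: derivative_eq_intros deriv)
    moreover have "Digamma (y + 2) \<le> ln (y + 2)"
      using y by (intro Digamma_real_bounds) simp
    moreover have "ln (y + 2) - ln (y + 1) \<le> 1 / (y + 1)"
      using ln_add_one_diff_le[of "y + 1"] y by (simp add: add.assoc)
    ultimately show "\<exists>d. ((\<lambda>y. ln (y + 1) - g y) has_real_derivative d) (at y) \<and> 0 \<le> d"
      by (intro exI[of _ "1 / (y + 1) - (Digamma (y + 2) - ln (y + 1))"]) auto
  qed
  moreover have "g 0 = 0"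
    by (simp add: g_def ln_Gamma_real_pos)
  ultimately show "0 \<le> ln_Gamma (x + 1) - (x * ln (x + 1) - x)"
    and "ln_Gamma (x + 1) - (x * ln (x + 1) - x) \<le> ln (x + 1)"
    by (simp_all add: g_def)
qed

text \<open>The error in Stirling's formula is at most \<open>1 + ln (x + 1)\<close>, and the tangent to \<open>ln\<close> at \<open>1 / \<delta>\<close>
bounds this by an affine function of slope \<open>\<delta>\<close>. Affine errors are what the later sums can absorb.\<close>

lemma ln_Gamma_stirling:
  fixes x \<delta> :: real
  assumes "0 \<le> x" and "0 < \<delta>"
  shows "0 \<le> ln (Gamma (x + 1)) - stirling_term x"
    and "ln (Gamma (x + 1)) - stirling_term x \<le> \<delta> * x + (\<delta> - ln \<delta>)"
proof -
  have eq: "ln_Gamma (x + 1) = ln (Gamma (x + 1))"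
    using assms by (simp add: ln_Gamma_real_pos)
  have diff: "x * ln x \<le> x * ln (x + 1)" "x * ln (x + 1) \<le> x * ln x + 1"
  proof -
    show "x * ln x \<le> x * ln (x + 1)"
      using assms by (cases "x = 0") auto
    show "x * ln (x + 1) \<le> x * ln x + 1"
    proof (cases "x = 0")
      case False
      then have "x * (ln (x + 1) - ln x) \<le> x * (1 / x)"
        using assms by (intro mult_left_mono ln_add_one_diff_le) auto
      then show ?thesis using False by (simp add: algebra_simps)
    qed simp
  qed
  have "ln (\<delta> * (x + 1)) \<le> \<delta> * (x + 1) - 1"
    using assms by (intro ln_le_minus_one) simp
  moreover have "ln (\<delta> * (x + 1)) = ln \<delta> + ln (x + 1)"
    using assms by (intro ln_mult_pos) auto
  ultimately have log: "ln (x + 1) + 1 \<le> \<delta> * x + (\<delta> - ln \<delta>)"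
    by (simp add: algebra_simps)
  show "0 \<le> ln (Gamma (x + 1)) - stirling_term x"
    using ln_Gamma_shifted_stirling(1)[OF assms(1)] diff eq by linarith
  show "ln (Gamma (x + 1)) - stirling_term x \<le> \<delta> * x + (\<delta> - ln \<delta>)"
    using ln_Gamma_shifted_stirling(2)[OF assms(1)] diff eq log by linarith
qed

text \<open>Splitting the logarithm is legitimate also at the boundary of the orthant, because each
logarithm is multiplied by a coordinate that vanishes with its argument. In this form continuity
up to the boundary and the dependence on \<open>lam\<close> become visible.\<close>

lemma Lambda_core_expand:
  fixes x lam :: "real ^ 'm::finite"
  assumes "0 < \<nu>" and lam: "\<And>i. 0 < lam $ i" and x: "\<And>i. 0 \<le> x $ i"
  shows "Lambda_core \<nu> lam x =
    (\<Sum>i\<in>UNIV. x $ i * ln (x $ i)) + (\<Sum>i\<in>UNIV. x $ i * (\<nu> * ln \<nu> - ln (lam $ i)))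
      - (1 - \<nu>) * (coord_sum x * ln (coord_sum x)) - \<nu> * coord_sum x"
proof -
  have summand: "x $ i * ln (\<nu> powr \<nu> / lam $ i * (x $ i / coord_sum x powr (1 - \<nu>))) =
      x $ i * ln (x $ i) + x $ i * (\<nu> * ln \<nu> - ln (lam $ i))
        - (1 - \<nu>) * (x $ i * ln (coord_sum x))" for i
  proof (cases "x $ i = 0")
    case False
    with x[of i] have "0 < x $ i" by simp
    moreover from this coord_le_coord_sum[of x i] x have "0 < coord_sum x" by fastforce
    ultimately show ?thesis
      using assms(1) lam[of i] by (simp add: ln_mult ln_div ln_powr algebra_simps)
  qed simp
  show ?thesis
    unfolding Lambda_core_def summand
    by (simp add: sum.distrib sum_subtractf coord_sum_def sum_distrib_left sum_distrib_right algebra_simps)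
qed

text \<open>The right-hand side is what remains of minus the logarithm of the weight when every
\<open>ln (Gamma (x + 1))\<close> is replaced by \<open>x * ln x - x\<close>; this is where the rate function comes from.\<close>

lemma time_Lambda_core_scaled_state:
  fixes lam :: "real ^ 'm::finite"
  assumes "0 < \<nu>" and lam: "\<And>i. 0 < lam $ i" and t: "0 < t"
  shows "t * Lambda_core \<nu> lam (scaled_state t k) =
    (\<Sum>i\<in>UNIV. stirling_term (real (k $ i))) - stirling_term (real (coord_sum k))
      + stirling_term (\<nu> * real (coord_sum k))
      - (\<Sum>i\<in>UNIV. real (k $ i) * ln (lam $ i)) - \<nu> * real (coord_sum k) * ln t"
proof -
  define n where "n = real (coord_sum k)"
  have n: "n = (\<Sum>i\<in>UNIV. real (k $ i))" "0 \<le> n"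
    by (simp_all add: n_def coord_sum_def sum_nonneg)
  have scale: "y * ln (y / t) = y * ln y - y * ln t" if "0 \<le> y" for y
    using t that by (cases "y = 0") (simp_all add: ln_div algebra_simps)
  have distrib: "t * (A + B - (1 - \<nu>) * C - \<nu> * (n / t)) = t * A + t * B - (1 - \<nu>) * (t * C) - \<nu> * n"
    for A B C
    using t by (simp add: field_simps)
  have cancel: "t * (y / t * z) = y * z" for y z
    using t by simp
  have "t * Lambda_core \<nu> lam (scaled_state t k) =
     (\<Sum>i\<in>UNIV. real (k $ i) * ln (real (k $ i) / t))
      + (\<Sum>i\<in>UNIV. real (k $ i) * (\<nu> * ln \<nu> - ln (lam $ i)))
      - (1 - \<nu>) * (n * ln (n / t)) - \<nu> * n"
    using t by (subst Lambda_core_expand[OF assms(1) lam])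
      (simp_all add: coord_sum_scaled_state n_def[symmetric] distrib cancel sum_distrib_left
        del: times_divide_eq_left times_divide_eq_right)
  also have "\<dots> = (\<Sum>i\<in>UNIV. real (k $ i) * ln (real (k $ i))) - n * ln t
      + (n * (\<nu> * ln \<nu>) - (\<Sum>i\<in>UNIV. real (k $ i) * ln (lam $ i)))
      - (1 - \<nu>) * (n * ln n - n * ln t) - \<nu> * n"
    using n(2) by (simp add: scale sum_subtractf right_diff_distrib
        sum_distrib_right[symmetric] n(1)[symmetric])
  also have "\<dots> = (\<Sum>i\<in>UNIV. stirling_term (real (k $ i))) - stirling_term n
      + stirling_term (\<nu> * n) - (\<Sum>i\<in>UNIV. real (k $ i) * ln (lam $ i)) - \<nu> * n * ln t"
    using n(2) assms(1)
    by (cases "n = 0") (simp_all add: sum_subtractf n(1)[symmetric] ln_mult algebra_simps)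
  finally show ?thesis by (simp add: n_def)
qed

lemma ln_jump_weight:
  fixes lam :: "real ^ 'm::finite"
  assumes "0 < \<nu>" and lam: "\<And>i. 0 < lam $ i" and t: "0 < t"
  shows "0 < jump_weight \<nu> lam t k"
    and "ln (jump_weight \<nu> lam t k) =
      ln (Gamma (real (coord_sum k) + 1)) - (\<Sum>i\<in>UNIV. ln (Gamma (real (k $ i) + 1)))
      - ln (Gamma (\<nu> * real (coord_sum k) + 1))
      + (\<Sum>i\<in>UNIV. real (k $ i) * ln (lam $ i)) + \<nu> * real (coord_sum k) * ln t"
proof -
  have fact: "fact j = Gamma (real j + 1)" for j
    using Gamma_fact[of j, where ?'a = real] by (simp add: add.commute)
  have G: "0 < Gamma (\<nu> * real (coord_sum k) + 1)"
    using assms(1) by (intro Gamma_real_pos add_nonneg_pos) auto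
  have prods: "0 < (\<Prod>i\<in>UNIV. fact (k $ i) :: real)" "0 < (\<Prod>i\<in>UNIV. (lam $ i) ^ (k $ i))"
    using lam by (auto intro!: prod_pos)
  show "0 < jump_weight \<nu> lam t k"
    unfolding jump_weight_def using G prods t by simp
  have "ln (jump_weight \<nu> lam t k) =
      ln (fact (coord_sum k)) - ln (\<Prod>i\<in>UNIV. fact (k $ i) :: real)
      + ln (\<Prod>i\<in>UNIV. (lam $ i) ^ (k $ i))
      + (\<nu> * real (coord_sum k) * ln t - ln (Gamma (\<nu> * real (coord_sum k) + 1)))"
    unfolding jump_weight_def using G prods t
    by (simp add: ln_mult ln_div ln_realpow del: prod_pos_nat_iff prod_zero_iff)
  also have "ln (\<Prod>i\<in>UNIV. fact (k $ i) :: real) = (\<Sum>i\<in>UNIV. ln (fact (k $ i)))"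
    by (subst ln_prod) auto
  also have "ln (\<Prod>i\<in>UNIV. (lam $ i) ^ (k $ i)) = (\<Sum>i\<in>UNIV. real (k $ i) * ln (lam $ i))"
    using less_imp_neq[OF lam, symmetric] by (subst ln_prod) (auto simp: ln_realpow)
  finally show "ln (jump_weight \<nu> lam t k) =
      ln (Gamma (real (coord_sum k) + 1)) - (\<Sum>i\<in>UNIV. ln (Gamma (real (k $ i) + 1)))
      - ln (Gamma (\<nu> * real (coord_sum k) + 1))
      + (\<Sum>i\<in>UNIV. real (k $ i) * ln (lam $ i)) + \<nu> * real (coord_sum k) * ln t"
    by (simp add: fact)
qed

text \<open>The two exponents differ by one Stirling error with positive sign, for the factorial of the
total, and by \<open>CARD('m) + 1\<close> errors with negative sign, for the coordinates and for the Gamma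
function. All errors are nonnegative, so each bound uses only those of one sign.\<close>

lemma jump_weight_bounds:
  fixes lam :: "real ^ 'm::finite"
  assumes "0 < \<nu>" and "\<nu> \<le> 1" and lam: "\<And>i. 0 < lam $ i" and t: "0 < t" and "0 < \<delta>"
  shows "jump_weight \<nu> lam t k \<le>
      exp (\<delta> * real (coord_sum k) + (\<delta> - ln \<delta>) - t * Lambda_core \<nu> lam (scaled_state t k))"
    and "exp (- (2 * \<delta> * real (coord_sum k) + (real CARD('m) + 1) * (\<delta> - ln \<delta>))
        - t * Lambda_core \<nu> lam (scaled_state t k)) \<le> jump_weight \<nu> lam t k"
proof -
  define n where "n = real (coord_sum k)"
  define e where "e x = ln (Gamma (x + 1)) - stirling_term x" for x :: real
  have n: "n = (\<Sum>i\<in>UNIV. real (k $ i))" "0 \<le> n"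
    by (simp_all add: n_def coord_sum_def sum_nonneg)
  have pos: "0 < jump_weight \<nu> lam t k"
    using ln_jump_weight(1) assms by blast
  have eq: "ln (jump_weight \<nu> lam t k) + t * Lambda_core \<nu> lam (scaled_state t k) =
      e n - (\<Sum>i\<in>UNIV. e (real (k $ i))) - e (\<nu> * n)"
    using ln_jump_weight(2)[OF assms(1,3,4)] time_Lambda_core_scaled_state[OF assms(1,3,4)]
    by (simp add: e_def n_def sum_subtractf)
  have e: "0 \<le> e x" "e x \<le> \<delta> * x + (\<delta> - ln \<delta>)" if "0 \<le> x" for x
    unfolding e_def using ln_Gamma_stirling[OF that assms(5)] by auto
  have "e n - (\<Sum>i\<in>UNIV. e (real (k $ i))) - e (\<nu> * n) \<le> \<delta> * n + (\<delta> - ln \<delta>)"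
    using e(2)[of n] e(1)[of "\<nu> * n"] n(2) assms(1)
      sum_nonneg[of UNIV "\<lambda>i. e (real (k $ i))"] e(1) by fastforce
  then have "ln (jump_weight \<nu> lam t k) \<le>
      \<delta> * n + (\<delta> - ln \<delta>) - t * Lambda_core \<nu> lam (scaled_state t k)"
    using eq by linarith
  then show "jump_weight \<nu> lam t k \<le>
      exp (\<delta> * real (coord_sum k) + (\<delta> - ln \<delta>) - t * Lambda_core \<nu> lam (scaled_state t k))"
    using pos by (metis n_def exp_le_cancel_iff exp_ln)
  have "(\<Sum>i\<in>UNIV. e (real (k $ i))) \<le> (\<Sum>i\<in>UNIV. \<delta> * real (k $ i) + (\<delta> - ln \<delta>))"
    by (intro sum_mono e) simp
  also have "\<dots> = \<delta> * n + real CARD('m) * (\<delta> - ln \<delta>)"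
    by (simp add: sum.distrib n(1) sum_distrib_left)
  finally have "(\<Sum>i\<in>UNIV. e (real (k $ i))) \<le> \<delta> * n + real CARD('m) * (\<delta> - ln \<delta>)" .
  moreover have "e (\<nu> * n) \<le> \<delta> * n + (\<delta> - ln \<delta>)"
  proof -
    have "\<delta> * (\<nu> * n) \<le> \<delta> * n"
      using assms n(2) by (simp add: mult_left_le_one_le)
    then show ?thesis using e(2)[of "\<nu> * n"] assms(1) n(2) by simp
  qed
  ultimately have "- (2 * \<delta> * n + (real CARD('m) + 1) * (\<delta> - ln \<delta>)) \<le>
      e n - (\<Sum>i\<in>UNIV. e (real (k $ i))) - e (\<nu> * n)"
    using e(1)[OF n(2)] by (simp add: algebra_simps)
  then have "- (2 * \<delta> * n + (real CARD('m) + 1) * (\<delta> - ln \<delta>))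
        - t * Lambda_core \<nu> lam (scaled_state t k) \<le> ln (jump_weight \<nu> lam t k)"
    using eq by linarith
  then show "exp (- (2 * \<delta> * real (coord_sum k) + (real CARD('m) + 1) * (\<delta> - ln \<delta>))
        - t * Lambda_core \<nu> lam (scaled_state t k)) \<le> jump_weight \<nu> lam t k"
    using pos by (metis n_def exp_le_cancel_iff exp_ln)
qed

section \<open>Minimum, coercivity and continuity of the rate function\<close>

definition orthant :: "(real ^ 'm::finite) set" where
  "orthant = {x. \<forall>i. 0 \<le> x $ i}"

abbreviation growth_rate :: "real \<Rightarrow> real ^ 'm::finite \<Rightarrow> real" where
  "growth_rate \<nu> lam \<equiv> coord_sum lam powr (1 / \<nu>)"

lemma coord_sum_pos:
  fixes lam :: "real ^ 'm::finite"
  assumes "\<And>i. 0 < lam $ i"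
  shows "0 < coord_sum lam"
  unfolding coord_sum_def using assms by (intro sum_pos) auto

lemma Lambda_star_eq:
  "Lambda_star \<nu> lam x =
     (if x \<in> orthant then ereal (Lambda_core \<nu> lam x + growth_rate \<nu> lam) else \<infinity>)"
  by (simp add: Lambda_star_def Lambda_core_def orthant_def)

lemma scaled_state_in_orthant: "0 < t \<Longrightarrow> scaled_state t k \<in> orthant"
  by (simp add: orthant_def)

text \<open>Gibbs' inequality for the proportions \<open>x $ i / s\<close> and \<open>lam $ i / L\<close> reduces the claim to a
function of \<open>u = \<nu> s\<close>, namely \<open>u ln (u / S) - u \<ge> - S\<close> with \<open>S\<close> the growth rate. Both steps are
instances of \<open>ln y \<ge> 1 - 1 / y\<close>.\<close>

lemma Lambda_core_ge:
  fixes lam x :: "real ^ 'm::finite"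
  assumes "0 < \<nu>" and lam: "\<And>i. 0 < lam $ i" and "x \<in> orthant"
  shows "- growth_rate \<nu> lam \<le> Lambda_core \<nu> lam x"
proof -
  define s where "s = coord_sum x"
  define L where "L = coord_sum lam"
  have x: "0 \<le> x $ i" for i
    using assms(3) by (simp add: orthant_def)
  have L: "0 < L"
    unfolding L_def by (rule coord_sum_pos[OF lam])
  have s_nonneg: "0 \<le> s"
    unfolding s_def by (rule coord_sum_nonneg[OF x])
  have log_ge: "1 - 1 / y \<le> ln y" if "0 < y" for y :: real
    using ln_le_minus_one[of "1 / y"] that by (simp add: ln_div)
  show ?thesis
  proof (cases "s = 0")
    case True
    then have "x $ i = 0" for i
      using coord_le_coord_sum[of x i] x[of i] x by (simp add: s_def)
    then show ?thesis
      using True by (simp add: Lambda_core_def s_def)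
  next
    case False
    with s_nonneg have s: "0 < s" by simp
    have summand: "x $ i * (\<nu> * ln (\<nu> * s) - ln L) + x $ i - lam $ i * s / L \<le>
        x $ i * ln (\<nu> powr \<nu> / lam $ i * (x $ i / s powr (1 - \<nu>)))" for i
    proof (cases "x $ i = 0")
      case True
      then show ?thesis using lam[of i] s L by simp
    next
      case False
      with x[of i] have xi: "0 < x $ i" by simp
      \<comment> \<open>the ratio of the proportions \<open>x $ i / s\<close> and \<open>lam $ i / L\<close>\<close>
      define y where "y = x $ i * L / (lam $ i * s)"
      have y: "0 < y" unfolding y_def using xi L lam[of i] s by simp
      have "ln (\<nu> powr \<nu> / lam $ i * (x $ i / s powr (1 - \<nu>))) =
          \<nu> * ln (\<nu> * s) - ln L + ln y"
        unfolding y_def using xi L lam[of i] s assms(1)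
        by (simp add: ln_mult ln_div algebra_simps)
      then have "x $ i * ln (\<nu> powr \<nu> / lam $ i * (x $ i / s powr (1 - \<nu>))) =
          x $ i * (\<nu> * ln (\<nu> * s) - ln L) + x $ i * ln y"
        by (simp only: distrib_left)
      moreover have "x $ i * (1 - 1 / y) = x $ i - lam $ i * s / L"
        unfolding y_def using xi L lam[of i] s by (simp add: field_simps)
      moreover have "x $ i * (1 - 1 / y) \<le> x $ i * ln y"
        using xi log_ge[OF y] by (intro mult_left_mono) auto
      ultimately show ?thesis by linarith
    qed
    define u where "u = \<nu> * s"
    have u: "0 < u" unfolding u_def using s assms(1) by simp
    have "(\<Sum>i\<in>UNIV. x $ i * (\<nu> * ln u - ln L) + x $ i - lam $ i * s / L)
        = s * (\<nu> * ln u - ln L) + s - L * s / L"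
      unfolding s_def L_def coord_sum_def
      by (simp add: sum.distrib sum_subtractf sum_distrib_right sum_divide_distrib)
    also have "\<dots> = u * (ln u - ln L / \<nu>)"
      using L assms(1) by (simp add: u_def field_simps)
    finally have sum_eq: "(\<Sum>i\<in>UNIV. x $ i * (\<nu> * ln u - ln L) + x $ i - lam $ i * s / L)
        = u * (ln u - ln L / \<nu>)" .
    have "u * (ln u - ln L / \<nu>) - u \<le> Lambda_core \<nu> lam x"
      unfolding Lambda_core_def s_def[symmetric] u_def[symmetric] sum_eq[symmetric]
      by (intro diff_right_mono sum_mono summand[folded u_def])
    moreover have "u * (1 - growth_rate \<nu> lam / u) \<le> u * (ln u - ln L / \<nu>)"
    proof (intro mult_left_mono)
      have "ln (u / growth_rate \<nu> lam) = ln u - ln L / \<nu>"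
        using u L by (simp add: L_def ln_div ln_powr)
      then show "1 - growth_rate \<nu> lam / u \<le> ln u - ln L / \<nu>"
        using log_ge[of "u / growth_rate \<nu> lam"] u L by (simp add: L_def)
    qed (use u in simp)
    ultimately show ?thesis
      using u by (simp add: right_diff_distrib)
  qed
qed

text \<open>Replacing \<open>lam\<close> by \<open>exp a *\<^sub>R lam\<close> subtracts \<open>a * coord_sum x\<close> from \<open>Lambda_core\<close>, so the bound is the
previous one for other parameters. It says that \<open>Lambda_core\<close> grows faster than linearly.\<close>

lemma Lambda_core_tilted_ge:
  fixes lam x :: "real ^ 'm::finite"
  assumes "0 < \<nu>" and lam: "\<And>i. 0 < lam $ i" and "x \<in> orthant"
  shows "- (exp (a / \<nu>) * growth_rate \<nu> lam) \<le> Lambda_core \<nu> lam x - a * coord_sum x"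
proof -
  have x: "0 \<le> x $ i" for i
    using assms(3) by (simp add: orthant_def)
  have lam': "0 < (exp a *\<^sub>R lam) $ i" for i
    using lam[of i] by simp
  have "Lambda_core \<nu> (exp a *\<^sub>R lam) x = Lambda_core \<nu> lam x - a * coord_sum x"
    using lam
    by (simp add: Lambda_core_expand[OF assms(1) lam' x] Lambda_core_expand[OF assms(1) lam x]
        ln_mult_pos algebra_simps sum.distrib sum_subtractf sum_distrib_left coord_sum_def)
  moreover have "growth_rate \<nu> (exp a *\<^sub>R lam) = exp (a / \<nu>) * growth_rate \<nu> lam"
  proof -
    have "coord_sum (exp a *\<^sub>R lam) = exp a * coord_sum lam"
      by (simp add: coord_sum_def sum_distrib_left)
    then show ?thesis
      using coord_sum_pos[OF lam] by (simp add: powr_mult exp_powr_real)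
  qed
  ultimately show ?thesis
    using Lambda_core_ge[OF assms(1) lam' assms(3)] by simp
qed

text \<open>Equality in Gibbs' inequality forces \<open>x\<close> to be a multiple of \<open>lam\<close>, and equality in the second
step forces \<open>\<nu> * coord_sum x\<close> to be the growth rate. At this point every logarithm in the
definition is \<open>0\<close>.\<close>

lemma Lambda_core_minimum:
  fixes lam :: "real ^ 'm::finite"
  assumes "0 < \<nu>" and lam: "\<And>i. 0 < lam $ i"
  obtains x where "x \<in> orthant" and "Lambda_core \<nu> lam x = - growth_rate \<nu> lam"
proof
  define L where "L = coord_sum lam"
  define S where "S = growth_rate \<nu> lam"
  define x where "x = (S / (\<nu> * L)) *\<^sub>R lam"
  have L: "0 < L"
    unfolding L_def by (rule coord_sum_pos[OF lam])
  have S: "0 < S" and ln_S: "\<nu> * ln S = ln L"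
    using L assms(1) by (simp_all add: S_def L_def ln_powr)
  have sum: "coord_sum x = S / \<nu>"
  proof -
    have "coord_sum x = S / (\<nu> * L) * L"
      by (simp add: x_def L_def coord_sum_def sum_distrib_left sum_divide_distrib)
    then show ?thesis using L by simp
  qed
  have "ln (\<nu> powr \<nu> / lam $ i * (x $ i / coord_sum x powr (1 - \<nu>))) = \<nu> * ln S - ln L" for i
  proof -
    have "ln (x $ i) = ln S - ln \<nu> - ln L + ln (lam $ i)"
      using S L lam[of i] assms(1) by (simp add: x_def ln_div ln_mult)
    moreover have "0 < x $ i"
      using S L lam[of i] assms(1) by (simp add: x_def)
    ultimately show ?thesis
      using S L lam[of i] assms(1) unfolding sum by (simp add: ln_div ln_mult algebra_simps)
  qed
  then show "Lambda_core \<nu> lam x = - growth_rate \<nu> lam"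
    using assms(1) by (simp add: Lambda_core_def ln_S sum S_def[symmetric])
  show "x \<in> orthant"
    using S L less_imp_le[OF lam] assms(1) by (simp add: x_def orthant_def)
qed

lemma continuous_on_x_ln_x: "continuous_on {0::real..} (\<lambda>x. x * ln x)"
  unfolding continuous_on_def
proof
  fix x :: real assume "x \<in> {0..}"
  then consider "x = 0" | "0 < x" by fastforce
  then show "((\<lambda>x. x * ln x) \<longlongrightarrow> x * ln x) (at x within {0..})"
  proof cases
    case 1
    have "((\<lambda>x::real. x * ln x) \<longlongrightarrow> 0) (at_right 0)"
      by real_asymp
    then show ?thesis
      by (simp add: 1 at_within_Ici_at_right)
  next
    case 2
    then have "((\<lambda>x. x * ln x) \<longlongrightarrow> x * ln x) (at x)"
      by (intro tendsto_intros) auto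
    then show ?thesis by (rule tendsto_within_subset) simp
  qed
qed

lemma continuous_on_Lambda_core:
  fixes lam :: "real ^ 'm::finite"
  assumes "0 < \<nu>" and lam: "\<And>i. 0 < lam $ i"
  shows "continuous_on orthant (Lambda_core \<nu> lam)"
proof -
  have coord: "continuous_on orthant (\<lambda>x. x $ i * ln (x $ i))" for i :: 'm
    by (rule continuous_on_compose2[OF continuous_on_x_ln_x, where f = "\<lambda>x. x $ i"])
      (auto simp: orthant_def intro!: continuous_intros)
  have total: "continuous_on orthant (\<lambda>x :: real ^ 'm. coord_sum x * ln (coord_sum x))"
    by (rule continuous_on_compose2[OF continuous_on_x_ln_x, where f = coord_sum])
      (auto simp: orthant_def coord_sum_def intro!: continuous_intros sum_nonneg)
  have cont_sum: "continuous_on orthant (coord_sum :: real ^ 'm \<Rightarrow> real)"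
    unfolding coord_sum_def by (intro continuous_intros)
  have "continuous_on orthant (\<lambda>x. (\<Sum>i\<in>UNIV. x $ i * ln (x $ i))
      + (\<Sum>i\<in>UNIV. x $ i * (\<nu> * ln \<nu> - ln (lam $ i)))
      - (1 - \<nu>) * (coord_sum x * ln (coord_sum x)) - \<nu> * coord_sum x)"
    by (intro continuous_intros coord total cont_sum)
  then show ?thesis
    by (rule continuous_on_eq) (auto simp: Lambda_core_expand[OF assms] orthant_def)
qed

lemma closed_orthant: "closed (orthant :: (real ^ 'm::finite) set)"
proof -
  have eq: "orthant = (\<Inter>i. {x :: real ^ 'm. 0 \<le> x $ i})"
    by (auto simp: orthant_def)
  show ?thesis
    unfolding eq by (auto intro!: closed_INT closed_Collect_le continuous_intros)
qed

lemma closed_Lambda_star_sublevel: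
  fixes lam :: "real ^ 'm::finite"
  assumes "0 < \<nu>" and "\<And>i. 0 < lam $ i"
  shows "closed {x. Lambda_star \<nu> lam x \<le> ereal y}"
proof -
  have "{x. Lambda_star \<nu> lam x \<le> ereal y} =
      {x \<in> orthant. Lambda_core \<nu> lam x \<le> y - growth_rate \<nu> lam}"
    by (auto simp: Lambda_star_eq)
  then show ?thesis
    using continuous_on_closed_Collect_le[OF continuous_on_Lambda_core[OF assms]
        continuous_on_const closed_orthant] by simp
qed

lemma Lambda_star_nonneg:
  fixes lam :: "real ^ 'm::finite"
  assumes "0 < \<nu>" and "\<And>i. 0 < lam $ i"
  shows "0 \<le> Lambda_star \<nu> lam x"
  using Lambda_core_ge[OF assms, of x] by (auto simp: Lambda_star_eq)

text \<open>The sublevel sets are closed because \<open>Lambda_core\<close> is continuous on the closed orthant, and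
bounded because the tilt with \<open>a = 1\<close> bounds \<open>coord_sum\<close>, which dominates the norm there.\<close>

lemma good_rate_function_Lambda_star:
  fixes lam :: "real ^ 'm::finite"
  assumes "0 < \<nu>" and lam: "\<And>i. 0 < lam $ i"
  shows "good_rate_function (Lambda_star \<nu> lam)"
  unfolding good_rate_function_def rate_function_def
proof (intro conjI allI impI)
  show "0 \<le> Lambda_star \<nu> lam z" for z
    by (rule Lambda_star_nonneg[OF assms])
  show "lower_semicontinuous (Lambda_star \<nu> lam)"
    unfolding lower_semicontinuous_def
  proof (intro allI impI)
    fix z :: "real ^ 'm" and y :: ereal
    assume "y < Lambda_star \<nu> lam z"
    then obtain r where r: "y < ereal r" "ereal r < Lambda_star \<nu> lam z"
      using ereal_dense2 by blast
    have "open {x. ereal r < Lambda_star \<nu> lam x}"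
      using closed_Lambda_star_sublevel[OF assms, of r]
      by (simp add: closed_def Compl_eq not_le)
    then have "\<forall>\<^sub>F w in nhds z. ereal r < Lambda_star \<nu> lam w"
      using r(2) by (auto simp: eventually_nhds)
    then show "\<forall>\<^sub>F w in nhds z. y < Lambda_star \<nu> lam w"
      by eventually_elim (use r(1) in order)
  qed
next
  fix \<gamma> :: real
  assume "0 \<le> \<gamma>"
  have "norm x \<le> \<gamma> + exp (1 / \<nu>) * growth_rate \<nu> lam" if "Lambda_star \<nu> lam x \<le> ereal \<gamma>" for x
  proof -
    from that have x: "x \<in> orthant" "Lambda_core \<nu> lam x + growth_rate \<nu> lam \<le> \<gamma>"
      by (auto simp: Lambda_star_eq split: if_splits)
    have "norm x \<le> (\<Sum>i\<in>UNIV. \<bar>x $ i\<bar>)"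
      by (rule norm_le_l1_cart)
    also have "\<dots> = coord_sum x"
      using x(1) by (simp add: orthant_def coord_sum_def)
    also have "\<dots> \<le> Lambda_core \<nu> lam x + exp (1 / \<nu>) * growth_rate \<nu> lam"
      using Lambda_core_tilted_ge[OF assms x(1), of 1] by simp
    also have "\<dots> \<le> \<gamma> + exp (1 / \<nu>) * growth_rate \<nu> lam"
      using x(2) powr_ge_zero[of "coord_sum lam" "1 / \<nu>"] by linarith
    finally show ?thesis .
  qed
  then have "bounded {x. Lambda_star \<nu> lam x \<le> ereal \<gamma>}"
    unfolding bounded_iff by blast
  then show "compact {x. Lambda_star \<nu> lam x \<le> ereal \<gamma>}"
    using closed_Lambda_star_sublevel[OF assms] by (simp add: compact_eq_bounded_closed)
qed

section \<open>Summation over lattice points\<close>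

lemma sum_power_coord_sum_box:
  fixes q :: real
  shows "(\<Sum>k\<in>{k :: nat ^ 'm::finite. \<forall>i. k $ i \<le> N}. q ^ coord_sum k) = (\<Sum>j\<le>N. q ^ j) ^ CARD('m)"
proof -
  have "(\<Sum>k\<in>{k :: nat ^ 'm. \<forall>i. k $ i \<le> N}. q ^ coord_sum k) =
      (\<Sum>g\<in>PiE (UNIV :: 'm set) (\<lambda>_. {..N}). \<Prod>i\<in>UNIV. q ^ g i)"
    by (rule sum.reindex_bij_witness[of _ vec_lambda vec_nth])
      (auto simp: coord_sum_def power_sum PiE_iff)
  also have "\<dots> = (\<Prod>i\<in>(UNIV :: 'm set). \<Sum>j\<le>N. q ^ j)"
    by (rule prod_sum_PiE[symmetric]) auto
  finally show ?thesis by simp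
qed

lemma finite_box: "finite {k :: nat ^ 'm::finite. \<forall>i. k $ i \<le> N}"
proof (rule finite_subset)
  show "{k :: nat ^ 'm. \<forall>i. k $ i \<le> N} \<subseteq> vec_lambda ` PiE UNIV (\<lambda>_. {..N})"
  proof
    fix k :: "nat ^ 'm" assume "k \<in> {k. \<forall>i. k $ i \<le> N}"
    then show "k \<in> vec_lambda ` PiE UNIV (\<lambda>_. {..N})"
      by (intro image_eqI[of _ _ "vec_nth k"]) auto
  qed
qed (simp add: finite_PiE)

text \<open>The sum of \<open>q ^ coord_sum k\<close> over the lattice is a product of \<open>CARD('m)\<close> geometric series.
Exhausting the lattice by boxes reduces the claim to finite sums.\<close>

lemma (in finite_measure) measure_geometric_bound:
  fixes X :: "'a \<Rightarrow> nat ^ 'm::finite"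
  assumes X: "X \<in> measurable M (count_space UNIV)" and q: "0 \<le> q" "q < 1" and "0 \<le> B"
    and bound: "\<And>k. k \<in> A \<Longrightarrow> measure M {\<omega> \<in> space M. X \<omega> = k} \<le> B * q ^ coord_sum k"
  shows "measure M {\<omega> \<in> space M. X \<omega> \<in> A} \<le> B * (1 / (1 - q)) ^ CARD('m)"
proof -
  define E where "E N = {\<omega> \<in> space M. X \<omega> \<in> A \<inter> {k. \<forall>i. k $ i \<le> N}}" for N
  have sets: "{\<omega> \<in> space M. X \<omega> \<in> K} \<in> sets M" for K
    using measurable_sets[OF X, of K] by (simp add: vimage_def Int_def conj_commute)
  have "measure M (E N) \<le> B * (1 / (1 - q)) ^ CARD('m)" for N
  proof -
    have fin: "finite (A \<inter> {k. \<forall>i. k $ i \<le> N})"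
      by (simp add: finite_box)
    have "E N = (\<Union>k\<in>A \<inter> {k. \<forall>i. k $ i \<le> N}. {\<omega> \<in> space M. X \<omega> = k})"
      by (auto simp: E_def)
    then have "measure M (E N) =
        (\<Sum>k\<in>A \<inter> {k. \<forall>i. k $ i \<le> N}. measure M {\<omega> \<in> space M. X \<omega> = k})"
      using fin sets[of "{_}"]
      by (simp only:) (intro finite_measure_finite_Union, auto simp: disjoint_family_on_def)
    also have "\<dots> \<le> (\<Sum>k\<in>A \<inter> {k. \<forall>i. k $ i \<le> N}. B * q ^ coord_sum k)"
      by (intro sum_mono bound) simp
    also have "\<dots> \<le> (\<Sum>k\<in>{k :: nat ^ 'm. \<forall>i. k $ i \<le> N}. B * q ^ coord_sum k)"
      using q assms(4) by (intro sum_mono2 finite_box) auto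
    also have "\<dots> = B * (\<Sum>j\<le>N. q ^ j) ^ CARD('m)"
      by (simp add: sum_distrib_left[symmetric] sum_power_coord_sum_box)
    also have "\<dots> \<le> B * (1 / (1 - q)) ^ CARD('m)"
    proof (intro mult_left_mono power_mono)
      show "(\<Sum>j\<le>N. q ^ j) \<le> 1 / (1 - q)"
        using q sum_le_suminf[of "\<lambda>j. q ^ j" "{..N}"]
        by (simp add: summable_geometric suminf_geometric)
    qed (use q assms(4) in \<open>auto intro: sum_nonneg\<close>)
    finally show ?thesis .
  qed
  moreover have "(\<lambda>N. measure M (E N)) \<longlonglongrightarrow> measure M (\<Union>N. E N)"
  proof (rule finite_Lim_measure_incseq)
    show "range E \<subseteq> sets M"
    proof (rule image_subsetI)
      show "E N \<in> sets M" for N unfolding E_def by (rule sets)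
    qed
    show "incseq E"
      by (auto simp: incseq_def E_def intro: order_trans)
  qed
  ultimately have "measure M (\<Union>N. E N) \<le> B * (1 / (1 - q)) ^ CARD('m)"
    by (intro LIMSEQ_le_const2) auto
  also have "(\<Union>N. E N) = {\<omega> \<in> space M. X \<omega> \<in> A}"
  proof -
    have "\<omega> \<in> E (Max (range (($) (X \<omega>))))" if "\<omega> \<in> space M" "X \<omega> \<in> A" for \<omega>
      using that by (simp add: E_def)
    then have "{\<omega> \<in> space M. X \<omega> \<in> A} \<subseteq> (\<Union>N. E N)"
      by blast
    moreover have "(\<Union>N. E N) \<subseteq> {\<omega> \<in> space M. X \<omega> \<in> A}"
      by (auto simp: E_def)
    ultimately show ?thesis by blast
  qed
  finally show ?thesis .
qed

section \<open>Exponential rates from exponential bounds\<close>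

lemma Limsup_log_prob_le:
  assumes p: "\<And>t. 0 \<le> p t"
    and bound: "\<And>\<epsilon>. 0 < \<epsilon> \<Longrightarrow> \<exists>C>0. \<forall>\<^sub>F t in at_top. p t \<le> C * exp (- t * (a - \<epsilon>))"
  shows "Limsup at_top (\<lambda>t. log_prob (p t) / ereal t) \<le> - ereal a"
  unfolding Limsup_le_iff
proof (intro allI impI)
  fix y assume "- ereal a < y"
  then obtain r where r: "- a < r" "ereal r < y"
    using ereal_dense2[of "- ereal a" y] by auto
  define \<epsilon> where "\<epsilon> = (r + a) / 2"
  have "0 < \<epsilon>" using r by (simp add: \<epsilon>_def)
  then obtain C where C: "0 < C" and ev: "\<forall>\<^sub>F t in at_top. p t \<le> C * exp (- t * (a - \<epsilon>))"
    using bound by blast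
  have "\<forall>\<^sub>F t in at_top. ln C / t < \<epsilon>"
  proof (rule order_tendstoD(2))
    show "((\<lambda>t. ln C / t) \<longlongrightarrow> 0) at_top" by real_asymp
  qed fact
  with ev eventually_gt_at_top[of 0]
  show "\<forall>\<^sub>F t in at_top. log_prob (p t) / ereal t < y"
  proof eventually_elim
    case (elim t)
    show ?case
    proof (cases "p t = 0")
      case True
      with elim r(2) show ?thesis by (auto simp: log_prob_def)
    next
      case False
      with p[of t] have "0 < p t" by simp
      then have "ln (p t) \<le> ln (C * exp (- t * (a - \<epsilon>)))"
        using elim C by (subst ln_le_cancel_iff) auto
      also have "\<dots> = ln C - t * (a - \<epsilon>)"
        using C by (simp add: ln_mult_pos)
      also have "\<dots> \<le> t * r"
        using elim(2,3) by (simp add: \<epsilon>_def field_simps)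
      finally have "ln (p t) / t \<le> r"
        using elim(2) by (simp add: field_simps)
      then have "log_prob (p t) / ereal t \<le> ereal r"
        using False elim(2) by (simp add: log_prob_def)
      with r(2) show ?thesis by order
    qed
  qed
qed

lemma Liminf_log_prob_ge:
  assumes bound: "\<And>\<epsilon>. 0 < \<epsilon> \<Longrightarrow> \<exists>C>0. \<forall>\<^sub>F t in at_top. C * exp (- t * (a + \<epsilon>)) \<le> p t"
  shows "- ereal a \<le> Liminf at_top (\<lambda>t. log_prob (p t) / ereal t)"
  unfolding le_Liminf_iff
proof (intro allI impI)
  fix y assume "y < - ereal a"
  then obtain r where r: "r < - a" "y < ereal r"
    using ereal_dense2[of y "- ereal a"] by auto
  define \<epsilon> where "\<epsilon> = (- a - r) / 2"
  have "0 < \<epsilon>" using r by (simp add: \<epsilon>_def)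
  then obtain C where C: "0 < C" and ev: "\<forall>\<^sub>F t in at_top. C * exp (- t * (a + \<epsilon>)) \<le> p t"
    using bound by blast
  have "\<forall>\<^sub>F t in at_top. - \<epsilon> < ln C / t"
  proof (rule order_tendstoD(1))
    show "((\<lambda>t. ln C / t) \<longlongrightarrow> 0) at_top" by real_asymp
  qed (use \<open>0 < \<epsilon>\<close> in simp)
  with ev eventually_gt_at_top[of 0]
  show "\<forall>\<^sub>F t in at_top. y < log_prob (p t) / ereal t"
  proof eventually_elim
    case (elim t)
    have "0 < C * exp (- t * (a + \<epsilon>))" using C by simp
    with elim have pos: "0 < p t" by linarith
    have "t * r \<le> ln C - t * (a + \<epsilon>)"
      using elim(2,3) by (simp add: \<epsilon>_def field_simps)
    also have "\<dots> = ln (C * exp (- t * (a + \<epsilon>)))"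
      using C by (simp add: ln_mult_pos)
    also have "\<dots> \<le> ln (p t)"
      using elim C pos by (subst ln_le_cancel_iff) auto
    finally have "r \<le> ln (p t) / t"
      using elim(2) by (simp add: field_simps)
    then have "ereal r \<le> log_prob (p t) / ereal t"
      using pos elim(2) by (simp add: log_prob_def)
    with r(2) show ?case by order
  qed
qed

section \<open>Large jump weights near a given point\<close>

lemma tendsto_floor_mult_div:
  fixes x :: real
  assumes "0 \<le> x"
  shows "((\<lambda>t. real (nat \<lfloor>t * x\<rfloor>) / t) \<longlongrightarrow> x) at_top"
proof (rule tendsto_sandwich)
  show "((\<lambda>t. x - 1 / t) \<longlongrightarrow> x) at_top" by real_asymp
  show "((\<lambda>t. x) \<longlongrightarrow> x) at_top" by simp
  show "\<forall>\<^sub>F t in at_top. x - 1 / t \<le> real (nat \<lfloor>t * x\<rfloor>) / t"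
    using eventually_gt_at_top[of 0]
  proof eventually_elim
    case (elim t)
    have "t * x - 1 \<le> real (nat \<lfloor>t * x\<rfloor>)"
      by linarith
    then have "(t * x - 1) / t \<le> real (nat \<lfloor>t * x\<rfloor>) / t"
      using elim by (intro divide_right_mono) simp_all
    then show ?case using elim by (simp add: diff_divide_distrib)
  qed
  show "\<forall>\<^sub>F t in at_top. real (nat \<lfloor>t * x\<rfloor>) / t \<le> x"
    using eventually_gt_at_top[of 0]
  proof eventually_elim
    case (elim t)
    then have "real (nat \<lfloor>t * x\<rfloor>) \<le> t * x"
      using assms by simp
    then show ?case using elim by (simp add: field_simps)
  qed
qed

text \<open>The state is \<open>t x\<close> with its coordinates rounded down: after scaling it tends to \<open>x\<close> within the
orthant, where \<open>Lambda_core\<close> is continuous, and its total is of order \<open>t\<close>, so the Stirling error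
is at most a small multiple of \<open>t\<close>.\<close>

lemma jump_weight_near:
  fixes lam x :: "real ^ 'm::finite"
  assumes "0 < \<nu>" and "\<nu> \<le> 1" and lam: "\<And>i. 0 < lam $ i"
    and x: "x \<in> orthant" and G: "open G" "x \<in> G" and "0 < \<epsilon>"
  shows "\<exists>c>0. \<forall>\<^sub>F t in at_top. \<exists>k. scaled_state t k \<in> G \<and>
    c * exp (- t * (Lambda_core \<nu> lam x + \<epsilon>)) \<le> jump_weight \<nu> lam t k"
proof -
  define k where "k t = (\<chi> i. nat \<lfloor>t * x $ i\<rfloor>)" for t
  define z where "z t = scaled_state t (k t)" for t
  \<comment> \<open>the Stirling error \<open>2 * \<delta> * coord_sum x\<close> per unit of time has to stay below \<open>\<epsilon>\<close>\<close>
  define \<delta> where "\<delta> = \<epsilon> / (2 * (coord_sum x + 1))"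
  have x': "0 \<le> x $ i" for i using x by (simp add: orthant_def)
  then have s: "0 \<le> coord_sum x" by (rule coord_sum_nonneg)
  have \<delta>: "0 < \<delta>" using s assms(7) by (simp add: \<delta>_def)
  have small: "2 * \<delta> * coord_sum x < \<epsilon>"
    using s assms(7) by (simp add: \<delta>_def field_simps)
  have lim: "(z \<longlongrightarrow> x) at_top"
    unfolding z_def k_def
    by (rule vec_tendstoI) (simp add: tendsto_floor_mult_div x')
  have "\<forall>\<^sub>F t in at_top. z t \<in> orthant"
    using eventually_gt_at_top[of 0]
    by eventually_elim (simp add: z_def scaled_state_in_orthant)
  then have "((\<lambda>t. Lambda_core \<nu> lam (z t)) \<longlongrightarrow> Lambda_core \<nu> lam x) at_top"
    by (rule continuous_on_tendsto_compose[OF continuous_on_Lambda_core[OF assms(1,3)] lim x])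
  moreover have "((\<lambda>t. coord_sum (z t)) \<longlongrightarrow> coord_sum x) at_top"
    unfolding coord_sum_def by (intro tendsto_intros lim)
  ultimately have "((\<lambda>t. 2 * \<delta> * coord_sum (z t) + Lambda_core \<nu> lam (z t))
      \<longlongrightarrow> 2 * \<delta> * coord_sum x + Lambda_core \<nu> lam x) at_top"
    by (intro tendsto_intros)
  then have ev: "\<forall>\<^sub>F t in at_top. 2 * \<delta> * coord_sum (z t) + Lambda_core \<nu> lam (z t)
      < Lambda_core \<nu> lam x + \<epsilon>"
    using small by (intro order_tendstoD(2)) auto
  define c where "c = exp (- ((real CARD('m) + 1) * (\<delta> - ln \<delta>)))"
  have "\<forall>\<^sub>F t in at_top. z t \<in> G"
    using lim G by (rule topological_tendstoD)
  with ev eventually_gt_at_top[of 0]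
  have "\<forall>\<^sub>F t in at_top. \<exists>k. scaled_state t k \<in> G \<and>
      c * exp (- t * (Lambda_core \<nu> lam x + \<epsilon>)) \<le> jump_weight \<nu> lam t k"
  proof eventually_elim
    case (elim t)
    have "real (coord_sum (k t)) = t * coord_sum (z t)"
      using elim by (simp add: z_def coord_sum_scaled_state)
    then have eq: "- (2 * \<delta> * real (coord_sum (k t)) + (real CARD('m) + 1) * (\<delta> - ln \<delta>))
        - t * Lambda_core \<nu> lam (z t) = - ((real CARD('m) + 1) * (\<delta> - ln \<delta>))
        + - t * (2 * \<delta> * coord_sum (z t) + Lambda_core \<nu> lam (z t))"
      by (simp add: algebra_simps)
    have "c * exp (- t * (Lambda_core \<nu> lam x + \<epsilon>)) \<le>
        c * exp (- t * (2 * \<delta> * coord_sum (z t) + Lambda_core \<nu> lam (z t)))"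
      using elim by (intro mult_left_mono) (auto simp: c_def)
    also have "\<dots> \<le> jump_weight \<nu> lam t (k t)"
      using jump_weight_bounds(2)[OF assms(1,2,3) elim(2) \<delta>, of "k t"]
      unfolding z_def[symmetric] eq exp_add c_def .
    finally show ?case using elim by (auto simp: z_def)
  qed
  moreover have "0 < c" by (simp add: c_def)
  ultimately show ?thesis by blast
qed

section \<open>Bounds at a fixed time\<close>

text \<open>The factor, independent of time, that is lost in the upper bounds: the constant part of the
Stirling error times the sum of \<open>exp (- \<delta>) ^ coord_sum k\<close> over the lattice.\<close>

definition overhead :: "('m::finite) itself \<Rightarrow> real \<Rightarrow> real" where
  "overhead _ \<delta> = exp (\<delta> - ln \<delta>) * (1 / (1 - exp (- \<delta>))) ^ CARD('m)"

text \<open>The normalizer \<open>Z\<close> is a free parameter: it is determined by the requirement that the point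
probabilities add up to \<open>1\<close>, and all information about it is extracted from that.\<close>

locale jump_law = prob_space P for P :: "'w measure" +
  fixes \<nu> t Z :: real and lam :: "real ^ 'm::finite" and X :: "'w \<Rightarrow> nat ^ 'm"
  assumes nu_pos: "0 < \<nu>" and nu_le_1: "\<nu> \<le> 1" and lam_pos: "\<And>i. 0 < lam $ i" and t_pos: "0 < t"
    and X_measurable: "X \<in> measurable P (count_space UNIV)"
    and prob_X: "\<And>k. prob {\<omega> \<in> space P. X \<omega> = k} = jump_weight \<nu> lam t k / Z"
begin

text \<open>Some point must have positive probability, for otherwise the summation bound with \<open>B = 0\<close> would
make the whole space a null set.\<close>

lemma Z_pos: "0 < Z"
proof (rule ccontr)
  assume "\<not> 0 < Z"
  then have "prob {\<omega> \<in> space P. X \<omega> = k} \<le> 0" for k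
    using ln_jump_weight(1)[OF nu_pos lam_pos t_pos, of k]
    by (simp add: prob_X divide_nonneg_nonpos)
  then have "prob {\<omega> \<in> space P. X \<omega> \<in> UNIV} \<le> 0 * (1 / (1 - 0)) ^ CARD('m)"
    by (intro measure_geometric_bound[OF X_measurable]) auto
  then show False by (simp add: prob_space)
qed

lemma jump_weight_le_Z: "jump_weight \<nu> lam t k \<le> Z"
  using prob_le_1[of "{\<omega> \<in> space P. X \<omega> = k}"] Z_pos by (simp add: prob_X)

text \<open>Taking the fraction \<open>\<delta>\<close> of \<open>Lambda_core\<close> and tilting it with \<open>a = 2\<close> produces a factor
\<open>exp (- 2 * \<delta> * coord_sum k)\<close>. One half of its exponent pays for the Stirling error and the
other half makes the sum over \<open>A\<close> converge. The remaining part of \<open>Lambda_core\<close> is at least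
\<open>(1 - \<delta>) * b\<close>.\<close>

lemma prob_upper:
  assumes \<delta>: "0 < \<delta>" "\<delta> \<le> 1"
    and b: "\<And>k. k \<in> A \<Longrightarrow> b \<le> Lambda_core \<nu> lam (scaled_state t k)"
  shows "prob {\<omega> \<in> space P. X \<omega> \<in> A} \<le> overhead TYPE('m) \<delta> *
    exp (- t * ((1 - \<delta>) * b - \<delta> * (exp (2 / \<nu>) * growth_rate \<nu> lam))) / Z"
proof -
  define R where "R = exp (2 / \<nu>) * growth_rate \<nu> lam"
  define B where "B = exp (\<delta> - ln \<delta>) * exp (- t * ((1 - \<delta>) * b - \<delta> * R)) / Z"
  have "prob {\<omega> \<in> space P. X \<omega> = k} \<le> B * exp (- \<delta>) ^ coord_sum k" if "k \<in> A" for k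
  proof -
    define H where "H = Lambda_core \<nu> lam (scaled_state t k)"
    define n where "n = real (coord_sum k)"
    have "- R \<le> H - 2 * (n / t)"
      using Lambda_core_tilted_ge[OF nu_pos lam_pos scaled_state_in_orthant[OF t_pos], of 2 k]
      by (simp add: R_def H_def n_def coord_sum_scaled_state)
    then have "\<delta> * (- R) \<le> \<delta> * (H - 2 * (n / t))"
      using \<delta> by (intro mult_left_mono) auto
    moreover have "(1 - \<delta>) * b \<le> (1 - \<delta>) * H"
      using \<delta> b[OF that] by (intro mult_left_mono) (auto simp: H_def)
    ultimately have "(1 - \<delta>) * b - \<delta> * R + 2 * \<delta> * (n / t) \<le> H"
      by (simp add: algebra_simps)
    then have "t * ((1 - \<delta>) * b - \<delta> * R + 2 * \<delta> * (n / t)) \<le> t * H"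
      using t_pos by (intro mult_left_mono) auto
    moreover have "t * ((1 - \<delta>) * b - \<delta> * R + 2 * \<delta> * (n / t)) =
        t * ((1 - \<delta>) * b - \<delta> * R) + 2 * \<delta> * n"
      using t_pos by (simp add: distrib_left)
    ultimately have "\<delta> * n + (\<delta> - ln \<delta>) - t * H \<le>
        (\<delta> - ln \<delta>) + - t * ((1 - \<delta>) * b - \<delta> * R) + n * - \<delta>"
      by (simp add: algebra_simps)
    then have "jump_weight \<nu> lam t k \<le>
        exp ((\<delta> - ln \<delta>) + - t * ((1 - \<delta>) * b - \<delta> * R) + n * - \<delta>)"
      using jump_weight_bounds(1)[OF nu_pos nu_le_1 lam_pos t_pos \<delta>(1), of k]
      unfolding H_def n_def by (meson exp_le_cancel_iff order_trans)
    also have "\<dots> = exp (\<delta> - ln \<delta>) * exp (- t * ((1 - \<delta>) * b - \<delta> * R)) * exp (- \<delta>) ^ coord_sum k"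
      by (simp only: exp_add exp_of_nat_mult n_def)
    finally show ?thesis
      using Z_pos by (simp add: prob_X B_def divide_right_mono)
  qed
  then have "prob {\<omega> \<in> space P. X \<omega> \<in> A} \<le> B * (1 / (1 - exp (- \<delta>))) ^ CARD('m)"
    using \<delta> Z_pos by (intro measure_geometric_bound[OF X_measurable]) (auto simp: B_def)
  also have "\<dots> = overhead TYPE('m) \<delta> * exp (- t * ((1 - \<delta>) * b - \<delta> * R)) / Z"
    by (simp add: B_def overhead_def)
  finally show ?thesis by (simp add: R_def)
qed

text \<open>The sure event has probability \<open>1\<close>, so the upper bound for \<open>A = UNIV\<close>, with the minimum of
\<open>Lambda_core\<close> as \<open>b\<close>, is a bound on \<open>Z\<close>.\<close>

lemma Z_upper:
  assumes \<delta>: "0 < \<delta>" "\<delta> \<le> 1"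
  shows "Z \<le> overhead TYPE('m) \<delta> *
    exp (t * (growth_rate \<nu> lam + \<delta> * (exp (2 / \<nu>) * growth_rate \<nu> lam)))"
proof -
  define S where "S = growth_rate \<nu> lam"
  have over: "0 \<le> overhead TYPE('m) \<delta>"
    using \<delta> by (simp add: overhead_def)
  have "prob {\<omega> \<in> space P. X \<omega> \<in> UNIV} \<le> overhead TYPE('m) \<delta> *
      exp (- t * ((1 - \<delta>) * - S - \<delta> * (exp (2 / \<nu>) * S))) / Z"
    unfolding S_def using Lambda_core_ge[OF nu_pos lam_pos scaled_state_in_orthant[OF t_pos]]
    by (intro prob_upper[OF \<delta>]) auto
  then have "Z \<le> overhead TYPE('m) \<delta> * exp (- t * ((1 - \<delta>) * - S - \<delta> * (exp (2 / \<nu>) * S)))"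
    using Z_pos by (simp add: prob_space)
  also have "\<dots> \<le> overhead TYPE('m) \<delta> * exp (t * (S + \<delta> * (exp (2 / \<nu>) * S)))"
  proof -
    have "0 \<le> t * (\<delta> * S)"
      using t_pos \<delta> by (simp add: S_def)
    then have "- t * ((1 - \<delta>) * - S - \<delta> * (exp (2 / \<nu>) * S)) \<le> t * (S + \<delta> * (exp (2 / \<nu>) * S))"
      by (simp add: algebra_simps)
    then show ?thesis using over by (intro mult_left_mono) auto
  qed
  finally show ?thesis by (simp add: S_def)
qed

end

section \<open>Large deviation bounds\<close>

context
  fixes P :: "'w measure" and \<nu> :: real and lam :: "real ^ 'm::finite"
    and M :: "real \<Rightarrow> 'w \<Rightarrow> nat ^ 'm" and Z :: "real \<Rightarrow> real"
  assumes law: "\<And>t. 0 < t \<Longrightarrow> jump_law P \<nu> t (Z t) lam (M t)"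
begin

lemma parameters: "0 < \<nu>" "\<nu> \<le> 1" "0 < lam $ i"
  using jump_law.nu_pos[OF law[OF zero_less_one]] jump_law.nu_le_1[OF law[OF zero_less_one]]
    jump_law.lam_pos[OF law[OF zero_less_one]] by blast+

text \<open>Every jump weight is at most \<open>Z t\<close>, and weights near the minimizer of \<open>Lambda_core\<close> grow at the rate
claimed.\<close>

lemma normalizer_lower:
  assumes "0 < \<epsilon>"
  shows "\<exists>c>0. \<forall>\<^sub>F t in at_top. c * exp (t * (growth_rate \<nu> lam - \<epsilon>)) \<le> Z t"
proof -
  obtain x where x: "x \<in> orthant" "Lambda_core \<nu> lam x = - growth_rate \<nu> lam"
    using Lambda_core_minimum[of \<nu> lam] parameters by blast
  obtain c where c: "0 < c" and ev: "\<forall>\<^sub>F t in at_top. \<exists>k. scaled_state t k \<in> UNIV \<and>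
      c * exp (- t * (Lambda_core \<nu> lam x + \<epsilon>)) \<le> jump_weight \<nu> lam t k"
    using jump_weight_near[OF parameters(1-3) x(1) open_UNIV UNIV_I assms] by blast
  from ev eventually_gt_at_top[of 0]
  have "\<forall>\<^sub>F t in at_top. c * exp (t * (growth_rate \<nu> lam - \<epsilon>)) \<le> Z t"
  proof eventually_elim
    case (elim t)
    then obtain k where "c * exp (- t * (Lambda_core \<nu> lam x + \<epsilon>)) \<le> jump_weight \<nu> lam t k"
      by blast
    also have "\<dots> \<le> Z t"
      using elim by (intro jump_law.jump_weight_le_Z[OF law])
    also have "- t * (Lambda_core \<nu> lam x + \<epsilon>) = t * (growth_rate \<nu> lam - \<epsilon>)"
      by (simp add: x(2) algebra_simps)
    finally show ?case .
  qed
  with c show ?thesis by blast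
qed

text \<open>Both the upper bound and the bound on the normalizer lose a multiple of \<open>\<delta> * t\<close> in the exponent.
The multiple depends only on \<open>a\<close> and the parameters, so a small \<open>\<delta>\<close> keeps the loss below \<open>\<epsilon> * t\<close>.\<close>

lemma prob_set_upper:
  assumes a: "\<And>x. x \<in> F \<inter> orthant \<Longrightarrow> a \<le> Lambda_core \<nu> lam x + growth_rate \<nu> lam"
    and "0 < \<epsilon>"
  shows "\<exists>C>0. \<forall>\<^sub>F t in at_top.
    measure P {\<omega> \<in> space P. scaled_state t (M t \<omega>) \<in> F} \<le> C * exp (- t * (a - \<epsilon>))"
proof -
  define S where "S = growth_rate \<nu> lam"
  define R where "R = exp (2 / \<nu>) * S"
  \<comment> \<open>\<open>\<delta> * (a - S + R + 1)\<close> is the total loss in the exponent, from the upper bound and from the normalizer\<close>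
  define \<delta> where "\<delta> = min 1 (\<epsilon> / (\<bar>a - S + R + 1\<bar> + 1))"
  have \<delta>: "0 < \<delta>" "\<delta> \<le> 1" using assms(2) by (auto simp: \<delta>_def)
  have "\<delta> * (a - S + R + 1) \<le> \<delta> * (\<bar>a - S + R + 1\<bar> + 1)"
    using \<delta> by (intro mult_left_mono) auto
  also have "\<dots> \<le> \<epsilon> / (\<bar>a - S + R + 1\<bar> + 1) * (\<bar>a - S + R + 1\<bar> + 1)"
    by (intro mult_right_mono) (auto simp: \<delta>_def)
  finally have loss: "\<delta> * (a - S + R + 1) \<le> \<epsilon>"
    by simp
  obtain c where c: "0 < c" and ev: "\<forall>\<^sub>F t in at_top. c * exp (t * (S - \<delta>)) \<le> Z t"
    using normalizer_lower[OF \<delta>(1)] unfolding S_def by blast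
  define C where "C = overhead TYPE('m) \<delta> / c"
  have over: "0 < overhead TYPE('m) \<delta>" using \<delta> by (simp add: overhead_def)
  from ev eventually_gt_at_top[of 0]
  have "\<forall>\<^sub>F t in at_top.
    measure P {\<omega> \<in> space P. scaled_state t (M t \<omega>) \<in> F} \<le> C * exp (- t * (a - \<epsilon>))"
  proof eventually_elim
    case (elim t)
    interpret jump_law P \<nu> t "Z t" lam "M t"
      using elim by (intro law)
    have "prob {\<omega> \<in> space P. scaled_state t (M t \<omega>) \<in> F} =
        prob {\<omega> \<in> space P. M t \<omega> \<in> {k. scaled_state t k \<in> F}}"
      by simp
    also have "\<dots> \<le> overhead TYPE('m) \<delta> * exp (- t * ((1 - \<delta>) * (a - S) - \<delta> * R)) / Z t"
      unfolding R_def S_def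
    proof (rule prob_upper[OF \<delta>])
      fix k assume "k \<in> {k. scaled_state t k \<in> F}"
      then show "a - growth_rate \<nu> lam \<le> Lambda_core \<nu> lam (scaled_state t k)"
        using a[of "scaled_state t k"] scaled_state_in_orthant[OF t_pos, of k] by simp
    qed
    also have "\<dots> \<le> overhead TYPE('m) \<delta> * exp (- t * ((1 - \<delta>) * (a - S) - \<delta> * R))
        / (c * exp (t * (S - \<delta>)))"
      using elim c over Z_pos by (intro divide_left_mono) auto
    also have "\<dots> = C * exp (- t * ((1 - \<delta>) * (a - S) - \<delta> * R) - t * (S - \<delta>))"
      unfolding exp_diff by (simp add: C_def)
    also have "\<dots> \<le> C * exp (- t * (a - \<epsilon>))"
    proof (intro mult_left_mono)
      have "t * (\<delta> * (a - S + R + 1)) \<le> t * \<epsilon>"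
        using loss t_pos by (intro mult_left_mono) auto
      then show "exp (- t * ((1 - \<delta>) * (a - S) - \<delta> * R) - t * (S - \<delta>)) \<le> exp (- t * (a - \<epsilon>))"
        by (simp add: algebra_simps)
    qed (use over c in \<open>simp add: C_def\<close>)
    finally show ?case .
  qed
  moreover have "0 < C" using over c by (simp add: C_def)
  ultimately show ?thesis by (intro exI[of _ C] conjI)
qed

lemma prob_open_lower:
  assumes x: "x \<in> orthant" and G: "open G" "x \<in> G" and "0 < \<epsilon>"
  shows "\<exists>C>0. \<forall>\<^sub>F t in at_top. C * exp (- t * (Lambda_core \<nu> lam x + growth_rate \<nu> lam + \<epsilon>))
    \<le> measure P {\<omega> \<in> space P. scaled_state t (M t \<omega>) \<in> G}"
proof -
  define S where "S = growth_rate \<nu> lam"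
  define R where "R = exp (2 / \<nu>) * S"
  define H where "H = Lambda_core \<nu> lam x"
  have R: "0 \<le> R" by (simp add: R_def S_def)
  \<comment> \<open>half of \<open>\<epsilon>\<close> is spent on the normalizer and half on the jump weight\<close>
  define \<delta> where "\<delta> = min 1 (\<epsilon> / (2 * (R + 1)))"
  have \<delta>: "0 < \<delta>" "\<delta> \<le> 1" using assms(4) R by (auto simp: \<delta>_def)
  have "\<delta> * R \<le> \<epsilon> / (2 * (R + 1)) * (R + 1)"
    using R assms(4) by (intro mult_mono) (auto simp: \<delta>_def)
  also have "\<dots> = \<epsilon> / 2" using R by (simp add: field_simps)
  finally have loss: "\<delta> * R \<le> \<epsilon> / 2" .
  obtain c where c: "0 < c" and ev: "\<forall>\<^sub>F t in at_top. \<exists>k. scaled_state t k \<in> G \<and>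
      c * exp (- t * (H + \<epsilon> / 2)) \<le> jump_weight \<nu> lam t k"
    using jump_weight_near[OF parameters(1-3) x G, of "\<epsilon> / 2"] assms(4) unfolding H_def by auto
  define C where "C = c / overhead TYPE('m) \<delta>"
  have over: "0 < overhead TYPE('m) \<delta>" using \<delta> by (simp add: overhead_def)
  from ev eventually_gt_at_top[of 0]
  have "\<forall>\<^sub>F t in at_top. C * exp (- t * (H + S + \<epsilon>))
    \<le> measure P {\<omega> \<in> space P. scaled_state t (M t \<omega>) \<in> G}"
  proof eventually_elim
    case (elim t)
    interpret jump_law P \<nu> t "Z t" lam "M t"
      using elim by (intro law)
    obtain k where k: "scaled_state t k \<in> G" "c * exp (- t * (H + \<epsilon> / 2)) \<le> jump_weight \<nu> lam t k"
      using elim by blast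
    have "C * exp (- t * (H + S + \<epsilon>)) \<le> C * exp (- t * (H + \<epsilon> / 2) - t * (S + \<delta> * R))"
    proof (intro mult_left_mono)
      have "t * (\<delta> * R) \<le> t * (\<epsilon> / 2)"
        using loss t_pos by (intro mult_left_mono) auto
      then show "exp (- t * (H + S + \<epsilon>)) \<le> exp (- t * (H + \<epsilon> / 2) - t * (S + \<delta> * R))"
        by (simp add: algebra_simps)
    qed (use over c in \<open>simp add: C_def\<close>)
    also have "\<dots> = c * exp (- t * (H + \<epsilon> / 2)) / (overhead TYPE('m) \<delta> * exp (t * (S + \<delta> * R)))"
      unfolding exp_diff by (simp add: C_def)
    also have "\<dots> \<le> jump_weight \<nu> lam t k / Z t"
      using k(2) Z_upper[OF \<delta>] Z_pos less_imp_le[OF ln_jump_weight(1)[OF nu_pos lam_pos t_pos, of k]]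
      unfolding R_def S_def by (intro frac_le) auto
    also have "\<dots> = prob {\<omega> \<in> space P. M t \<omega> = k}"
      by (simp add: prob_X)
    also have "\<dots> \<le> prob {\<omega> \<in> space P. scaled_state t (M t \<omega>) \<in> G}"
    proof (rule finite_measure_mono)
      show "{\<omega> \<in> space P. scaled_state t (M t \<omega>) \<in> G} \<in> events"
        using measurable_sets[OF X_measurable, of "{k. scaled_state t k \<in> G}"]
        by (simp add: vimage_def Int_def conj_commute)
    qed (use k(1) in auto)
    finally show ?case .
  qed
  moreover have "0 < C" using over c by (simp add: C_def)
  ultimately show ?thesis unfolding H_def S_def by (intro exI[of _ C] conjI)
qed

lemma Limsup_prob_set_le:
  "Limsup at_top (\<lambda>t. log_prob (measure P {\<omega> \<in> space P. scaled_state t (M t \<omega>) \<in> F}) / ereal t)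
     \<le> - (INF x\<in>F. Lambda_star \<nu> lam x)"
proof (cases "F \<inter> orthant = {}")
  case True
  have "\<forall>\<^sub>F t in at_top.
      log_prob (measure P {\<omega> \<in> space P. scaled_state t (M t \<omega>) \<in> F}) / ereal t \<le> - \<infinity>"
    using eventually_gt_at_top[of 0]
  proof eventually_elim
    case (elim t)
    then have "{\<omega> \<in> space P. scaled_state t (M t \<omega>) \<in> F} = {}"
      using True scaled_state_in_orthant[OF elim] by blast
    then have "measure P {\<omega> \<in> space P. scaled_state t (M t \<omega>) \<in> F} = 0"
      by (simp only: measure_empty)
    with elim show ?case by (simp add: log_prob_def)
  qed
  then have "Limsup at_top (\<lambda>t. log_prob (measure P {\<omega> \<in> space P. scaled_state t (M t \<omega>) \<in> F}) / ereal t)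
      \<le> - \<infinity>"
    by (rule Limsup_bounded)
  then show ?thesis by simp
next
  case False
  then obtain x where x: "x \<in> F" "x \<in> orthant" by blast
  define J where "J = (INF x\<in>F. Lambda_star \<nu> lam x)"
  have "0 \<le> J"
    unfolding J_def by (intro INF_greatest Lambda_star_nonneg parameters)
  moreover have "J \<le> Lambda_star \<nu> lam x"
    unfolding J_def by (intro INF_lower x)
  ultimately obtain a where a: "J = ereal a"
    using x(2) by (cases J) (auto simp: Lambda_star_eq)
  have "a \<le> Lambda_core \<nu> lam y + growth_rate \<nu> lam" if "y \<in> F \<inter> orthant" for y
  proof -
    have "J \<le> Lambda_star \<nu> lam y"
      unfolding J_def using that by (intro INF_lower) auto
    then show ?thesis using that by (simp add: a Lambda_star_eq)
  qed
  then have "Limsup at_top (\<lambda>t. log_prob (measure P {\<omega> \<in> space P. scaled_state t (M t \<omega>) \<in> F}) / ereal t)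
      \<le> - ereal a"
    by (intro Limsup_log_prob_le prob_set_upper) auto
  then show ?thesis by (simp only: a[symmetric] J_def)
qed

lemma Liminf_prob_open_ge:
  assumes "open G"
  shows "- (INF x\<in>G. Lambda_star \<nu> lam x) \<le>
    Liminf at_top (\<lambda>t. log_prob (measure P {\<omega> \<in> space P. scaled_state t (M t \<omega>) \<in> G}) / ereal t)"
    (is "_ \<le> ?L")
proof -
  have "- ?L \<le> Lambda_star \<nu> lam x" if "x \<in> G" for x
  proof (cases "x \<in> orthant")
    case True
    then have "- ereal (Lambda_core \<nu> lam x + growth_rate \<nu> lam) \<le> ?L"
      by (intro Liminf_log_prob_ge prob_open_lower assms that)
    then show ?thesis
      using True by (simp add: Lambda_star_eq ereal_uminus_le_reorder)
  qed (simp add: Lambda_star_eq)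
  then have "- ?L \<le> (INF x\<in>G. Lambda_star \<nu> lam x)"
    by (rule INF_greatest)
  then show ?thesis by (simp add: ereal_uminus_le_reorder)
qed

end

theorem proposition1:
  fixes P :: "'w measure" and \<nu> :: real and lam :: "real ^ 'm::finite"
    and M :: "real \<Rightarrow> 'w \<Rightarrow> nat ^ 'm"
  assumes "prob_space P"
    and "0 < \<nu>" and "\<nu> \<le> 1"
    and "\<And>i. 0 < lam $ i"
    and "multivariate_alt_fractional_Poisson P \<nu> lam M"
  shows "large_deviation_principle P (\<lambda>t \<omega>. (\<chi> i. real (M t \<omega> $ i) / t)) (\<lambda>t. t) (Lambda_star \<nu> lam)
     \<and> good_rate_function (Lambda_star \<nu> lam)"
proof
  show good: "good_rate_function (Lambda_star \<nu> lam)"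
    by (rule good_rate_function_Lambda_star[OF assms(2,4)])
  define Z where "Z t = Mittag_Leffler \<nu> 1 (coord_sum lam * t powr \<nu>)" for t
  have M: "M t \<in> measurable P (count_space UNIV)"
    and prob: "measure P {\<omega> \<in> space P. M t \<omega> = k} = jump_weight \<nu> lam t k / Z t"
    if "0 < t" for t k
    using assms(5) that
    by (auto simp: multivariate_alt_fractional_Poisson_def jump_weight_def Z_def)
  have law: "jump_law P \<nu> t (Z t) lam (M t)" if "0 < t" for t
    unfolding jump_law_def jump_law_axioms_def using assms(1-4) M prob that by auto
  show "large_deviation_principle P (\<lambda>t \<omega>. scaled_state t (M t \<omega>)) (\<lambda>t. t) (Lambda_star \<nu> lam)"
    unfolding large_deviation_principle_def
  proof (intro conjI allI impI)
    show "filterlim (\<lambda>t::real. t) at_top at_top"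
      by (rule filterlim_ident)
    show "rate_function (Lambda_star \<nu> lam)"
      using good by (simp add: good_rate_function_def)
    show "(\<lambda>\<omega>. scaled_state t (M t \<omega>)) \<in> borel_measurable P" if "0 < t" for t
      by (rule measurable_compose[OF M[OF that]]) simp
  qed (use Limsup_prob_set_le[OF law] Liminf_prob_open_ge[OF law] in auto)
qed

end
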